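(* Let $\mathcal{M}$ be a symmetric moment functional whose recurrence coefficients $\gamma_n$ satisfy conditions $(\mathcal{C}_1)$–$(\mathcal{C}_7)$. For real $\omega$ let $e_\omega(t)=e^{\mathrm{i}\omega t}$. Then every complex exponential $e_\omega$, $\omega\in\mathbb{R}$, belongs to the associated space $\mathcal{B}_2$ (that is, $e_\omega\in\mathcal{B}$, and $e_\omega$ is taken modulo $\mathcal{B}_0$), and for all real $\omega\neq\sigma$ and all $t\in\mathbb{R}$, $$\lim_{n\to\infty}\frac{\sum_{k=0}^{n}\mathcal{K}^k[e_\omega](t)\,\mathcal{K}^k[\overline{e_\sigma}](t)}{\sum_{j=0}^{n}\frac{1}{\gamma_j}}=0 .$$
   Context: $\mathcal{M}$ is a linear functional on polynomials with real coefficients in $\omega$, with moments $\mu_n=\mathcal{M}(\omega^n)$; it is positive definite (all Hankel determinants $\det(\mu_{i+j})_{i,j=0}^n$ are $>0$), normalised ($\mu_0=1$) and symmetric ($\mu_{2n+1}=0$ for all $n$). $(p_n)$ are its orthonormal polynomials: $\deg p_n=n$, $\mathcal{M}(p_np_m)=\delta(m-n)$, $p_0\equiv1$, satisfying, with $p_{-1}\equiv0$, $\gamma_{-1}=1$, the recurrence $p_{n+1}(\omega)=\frac{\omega}{\gamma_n}p_n(\omega)-\frac{\gamma_{n-1}}{\gamma_n}p_{n-1}(\omega)$ with $\gamma_n>0$. Chromatic derivatives: $\mathcal{K}^n=\mathrm{i}^np_n(-\mathrm{i}\,d/dt)$ (they have real coefficients in the symmetric case). Let $\mathrm{s}(n)=\gamma_{n+1}-\gamma_n$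 and $\mathrm{ds}(n)=\mathrm{s}(n+1)-\mathrm{s}(n)$. Conditions: $(\mathcal{C}_1)$ $\gamma_n\to\infty$; $(\mathcal{C}_2)$ $\mathrm{s}(n)\to0$; $(\mathcal{C}_3)$ there exist $n_0,m_0$ such that $\gamma_{n+m}>\gamma_n$ for all $n\ge n_0$ and $m\ge m_0$; $(\mathcal{C}_4)$ $\sum_{j=0}^\infty\frac1{\gamma_j}=\infty$; $(\mathcal{C}_5)$ there is $\kappa>1$ with $\sum_{j=0}^\infty\frac1{\gamma_j^\kappa}<\infty$; $(\mathcal{C}_6)$ $\sum_{n=0}^\infty\frac{|\mathrm{s}(n)|}{\gamma_n^2}<\infty$; $(\mathcal{C}_7)$ $\sum_{n=0}^\infty\frac{|\mathrm{ds}(n)|}{\gamma_n}<\infty$. $\mathcal{B}$ is the collection of infinitely differentiable functions $f:\mathbb{R}\to\mathbb{C}$ for which the sequence $\beta_n^f(t)=\gamma_n\left(|\mathcal{K}^n[f](t)|^2+|\mathcal{K}^{n+1}[f](t)|^2\right)$ converges uniformly on every compact interval of $\mathbb{R}$. For $f\in\mathcal{B}$ the limit $\lim_{n\to\infty}\sqrt{\sum_{k=0}^n|\mathcal{K}^k[f](t)|^2\big/\sum_{k=0}^n\frac1{\gamma_k}}$ exists and does not depend on $t$; $\mathcal{B}_0\subset\mathcal{B}$ is the set of $f\in\mathcal{B}$ for which it equals $0$, and $\mathcal{B}_2=\mathcal{B}/\mathcal{B}_0$ (functions in $\mathcal{B}$ identified when their difference lies in $\mathcal{B}_0$). *)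

theory Defs
  imports "HOL-Analysis.Analysis" "Jordan_Normal_Form.Determinant"
begin

text \<open>The determinant is that of Jordan_Normal_Form, whose matrices have their size as a term; the
  one of HOL-Analysis has the same name. The polynomial constants are qualified because HOL-Algebra,
  which comes with Jordan_Normal_Form, has constants of the same names.\<close>

definition moment :: "(real poly \<Rightarrow> real) \<Rightarrow> nat \<Rightarrow> real" where
  "moment M n = M (Polynomial.monom 1 n)"

definition positive_definite_functional :: "(real poly \<Rightarrow> real) \<Rightarrow> bool" where
  "positive_definite_functional M \<longleftrightarrow>
     (\<forall>n. Determinant.det (mat (Suc n) (Suc n) (\<lambda>(i, j). moment M (i + j))) > 0)"

definition symmetric_moment_functional :: "(real poly \<Rightarrow> real) \<Rightarrow> bool" where
  "symmetric_moment_functional M \<longleftrightarrow>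
     Vector_Spaces.linear Polynomial.smult (*) M \<and>
     positive_definite_functional M \<and>
     moment M 0 = 1 \<and>
     (\<forall>n. moment M (2 * n + 1) = 0)"

definition orthonormal_polys :: "(real poly \<Rightarrow> real) \<Rightarrow> (nat \<Rightarrow> real poly) \<Rightarrow> bool" where
  "orthonormal_polys M p \<longleftrightarrow>
     p 0 = 1 \<and>
     (\<forall>n. Polynomial.degree (p n) = n) \<and>
     (\<forall>m n. M (p n * p m) = (if m = n then 1 else 0))"

text \<open>The instance \<open>n = 0\<close> of the three-term recurrence, in which \<open>p\<^sub>-\<^sub>1 = 0\<close>, is stated separately,
  so that indices remain natural numbers. Together with \<^const>\<open>orthonormal_polys\<close> this determines
  \<open>p\<close> and \<open>\<gamma>\<close> uniquely.\<close>

definition recurrence_coeffs :: "(nat \<Rightarrow> real poly) \<Rightarrow> (nat \<Rightarrow> real) \<Rightarrow> bool" where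
  "recurrence_coeffs p \<gamma> \<longleftrightarrow>
     (\<forall>n. \<gamma> n > 0) \<and>
     p 1 = Polynomial.smult (1 / \<gamma> 0) ([:0, 1:] * p 0) \<and>
     (\<forall>n. p (n + 2) = Polynomial.smult (1 / \<gamma> (n + 1)) ([:0, 1:] * p (n + 1))
                        - Polynomial.smult (\<gamma> n / \<gamma> (n + 1)) (p n))"

definition s :: "(nat \<Rightarrow> real) \<Rightarrow> nat \<Rightarrow> real" where
  "s \<gamma> n = \<gamma> (n + 1) - \<gamma> n"

definition ds :: "(nat \<Rightarrow> real) \<Rightarrow> nat \<Rightarrow> real" where
  "ds \<gamma> n = s \<gamma> (n + 1) - s \<gamma> n"

definition cond_C1 :: "(nat \<Rightarrow> real) \<Rightarrow> bool" where
  "cond_C1 \<gamma> \<longleftrightarrow> filterlim \<gamma> at_top sequentially"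

definition cond_C2 :: "(nat \<Rightarrow> real) \<Rightarrow> bool" where
  "cond_C2 \<gamma> \<longleftrightarrow> s \<gamma> \<longlonglongrightarrow> 0"

definition cond_C3 :: "(nat \<Rightarrow> real) \<Rightarrow> bool" where
  "cond_C3 \<gamma> \<longleftrightarrow> (\<exists>n0 m0. \<forall>n\<ge>n0. \<forall>m\<ge>m0. \<gamma> (n + m) > \<gamma> n)"

definition cond_C4 :: "(nat \<Rightarrow> real) \<Rightarrow> bool" where
  "cond_C4 \<gamma> \<longleftrightarrow> filterlim (\<lambda>n. \<Sum>j\<le>n. 1 / \<gamma> j) at_top sequentially"

definition cond_C5 :: "(nat \<Rightarrow> real) \<Rightarrow> bool" where
  "cond_C5 \<gamma> \<longleftrightarrow> (\<exists>\<kappa>::real. \<kappa> > 1 \<and> summable (\<lambda>j. 1 / \<gamma> j powr \<kappa>))"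

definition cond_C6 :: "(nat \<Rightarrow> real) \<Rightarrow> bool" where
  "cond_C6 \<gamma> \<longleftrightarrow> summable (\<lambda>n. \<bar>s \<gamma> n\<bar> / (\<gamma> n)\<^sup>2)"

definition cond_C7 :: "(nat \<Rightarrow> real) \<Rightarrow> bool" where
  "cond_C7 \<gamma> \<longleftrightarrow> summable (\<lambda>n. \<bar>ds \<gamma> n\<bar> / \<gamma> n)"

definition ddt :: "(real \<Rightarrow> complex) \<Rightarrow> real \<Rightarrow> complex" where
  "ddt f = (\<lambda>t. vector_derivative f (at t))"

definition infinitely_differentiable :: "(real \<Rightarrow> complex) \<Rightarrow> bool" where
  "infinitely_differentiable f \<longleftrightarrow> (\<forall>n t. (ddt ^^ n) f differentiable (at t))"

text \<open>The operator \<open>\<i>\<^sup>n p\<^sub>n(-\<i> d/dt)\<close>.\<close>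

definition chromatic_deriv ::
    "(nat \<Rightarrow> real poly) \<Rightarrow> nat \<Rightarrow> (real \<Rightarrow> complex) \<Rightarrow> real \<Rightarrow> complex" where
  "chromatic_deriv p n f t =
     \<i> ^ n * (\<Sum>k\<le>Polynomial.degree (p n). complex_of_real (Polynomial.coeff (p n) k) * (- \<i>) ^ k * (ddt ^^ k) f t)"

definition beta ::
    "(nat \<Rightarrow> real poly) \<Rightarrow> (nat \<Rightarrow> real) \<Rightarrow> (real \<Rightarrow> complex) \<Rightarrow> nat \<Rightarrow> real \<Rightarrow> real" where
  "beta p \<gamma> f n t =
     \<gamma> n * ((cmod (chromatic_deriv p n f t))\<^sup>2 + (cmod (chromatic_deriv p (n + 1) f t))\<^sup>2)"

definition space_B :: "(nat \<Rightarrow> real poly) \<Rightarrow> (nat \<Rightarrow> real) \<Rightarrow> (real \<Rightarrow> complex) set" where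
  "space_B p \<gamma> =
     {f. infinitely_differentiable f \<and> (\<forall>a b. uniformly_convergent_on {a..b} (beta p \<gamma> f))}"

text \<open>For functions in \<^const>\<open>space_B\<close> the limit below does not depend on \<open>t\<close>, so requiring it to
  vanish for every \<open>t\<close> is the same as for some \<open>t\<close>.\<close>

definition space_B0 :: "(nat \<Rightarrow> real poly) \<Rightarrow> (nat \<Rightarrow> real) \<Rightarrow> (real \<Rightarrow> complex) set" where
  "space_B0 p \<gamma> =
     {f \<in> space_B p \<gamma>. \<forall>t.
        (\<lambda>n. sqrt ((\<Sum>k\<le>n. (cmod (chromatic_deriv p k f t))\<^sup>2) / (\<Sum>k\<le>n. 1 / \<gamma> k)))
          \<longlonglongrightarrow> 0}"

definition B0_rel ::
    "(nat \<Rightarrow> real poly) \<Rightarrow> (nat \<Rightarrow> real) \<Rightarrow> ((real \<Rightarrow> complex) \<times> (real \<Rightarrow> complex)) set" where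
  "B0_rel p \<gamma> =
     {(f, g). f \<in> space_B p \<gamma> \<and> g \<in> space_B p \<gamma> \<and> (\<lambda>t. f t - g t) \<in> space_B0 p \<gamma>}"

definition space_B2 :: "(nat \<Rightarrow> real poly) \<Rightarrow> (nat \<Rightarrow> real) \<Rightarrow> (real \<Rightarrow> complex) set set" where
  "space_B2 p \<gamma> = space_B p \<gamma> // B0_rel p \<gamma>"

definition cexp :: "real \<Rightarrow> real \<Rightarrow> complex" where
  "cexp \<omega> t = exp (\<i> * complex_of_real \<omega> * complex_of_real t)"

end

theory Submission
  imports Defs
begin

text \<open>On an exponential the chromatic derivatives act as multipliers:
  \<open>\<K>\<^sup>n[e\<^sub>\<omega>] = \<i>\<^sup>n p\<^sub>n(\<omega>) e\<^sub>\<omega>\<close>. Hence \<open>\<beta>\<^sub>n\<close> does not depend on \<open>t\<close>, and membership of \<open>e\<^sub>\<omega>\<close> in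
  the space \<open>\<B>\<close> says that the numerical sequence \<open>\<gamma>\<^sub>n (x\<^sub>n\<^sup>2 + x\<^sub>n\<^sub>+\<^sub>1\<^sup>2)\<close>, \<open>x\<^sub>n = p\<^sub>n(\<omega>)\<close>, converges.

  The recurrence makes \<open>x\<^sub>n\<^sub>+\<^sub>2\<close> close to \<open>- x\<^sub>n\<close>, so this sequence is almost constant, but the
  increments of the natural invariant \<open>\<gamma>\<^sub>n (x\<^sub>n\<^sup>2 + x\<^sub>n\<^sub>+\<^sub>1\<^sup>2) - \<omega> x\<^sub>n x\<^sub>n\<^sub>+\<^sub>1\<close> have relative size
  \<open>s(n)/\<gamma>\<^sub>n\<close>, which need not be summable. Their main part is \<open>s(n) (x\<^sub>n\<^sub>+\<^sub>1\<^sup>2 - x\<^sub>n\<^sup>2)\<close>, which a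
  summation by parts turns into a second difference: after subtracting \<open>s(n) x\<^sub>n\<^sup>2\<close> the increments
  are of relative size \<open>\<bar>ds(n)\<bar>/\<gamma>\<^sub>n + \<bar>s(n)\<bar>/\<gamma>\<^sub>n\<^sup>2\<close> (lemma \<open>energy_increment\<close>), which is summable by
  \<open>\<C>\<^sub>6\<close> and \<open>\<C>\<^sub>7\<close>. A sequence with summable relative increments converges
  (\<open>convergent_of_summable_relative_increments\<close>), and the correction terms are negligible because
  \<open>\<gamma>\<^sub>n \<rightarrow> \<infinity>\<close>.

  For the orthogonality, symmetry of the functional turns the summand into
  \<open>p\<^sub>k(\<omega>) p\<^sub>k(\<sigma>) e\<^sub>\<omega>\<^sub>-\<^sub>\<sigma>\<close>. By the Christoffel-Darboux identity the sum is
  \<open>\<gamma>\<^sub>n (p\<^sub>n\<^sub>+\<^sub>1(\<omega>) p\<^sub>n(\<sigma>) - p\<^sub>n(\<omega>) p\<^sub>n\<^sub>+\<^sub>1(\<sigma>)) / (\<omega> - \<sigma>)\<close>, which is bounded because both sequences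
  \<open>\<beta>\<^sub>n\<close> are, whereas \<open>\<Sum> 1/\<gamma>\<^sub>j\<close> diverges by \<open>\<C>\<^sub>4\<close>.\<close>

section \<open>Convergence of the weighted squares\<close>

text \<open>Consecutive terms differ by a factor at most \<open>1 + \<epsilon> n \<le> exp (\<epsilon> n)\<close>, so the sequence is bounded;
  hence its increments are absolutely summable.\<close>

lemma convergent_of_summable_relative_increments:
  fixes E \<epsilon> :: "nat \<Rightarrow> real"
  assumes sum: "summable \<epsilon>" and nonneg: "\<And>n. \<epsilon> n \<ge> 0"
    and inc: "eventually (\<lambda>n. \<bar>E (Suc n) - E n\<bar> \<le> \<epsilon> n * \<bar>E n\<bar>) sequentially"
  shows "convergent E"
proof -
  obtain N where N: "\<And>n. n \<ge> N \<Longrightarrow> \<bar>E (Suc n) - E n\<bar> \<le> \<epsilon> n * \<bar>E n\<bar>"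
    using inc by (auto simp: eventually_sequentially)
  have growth: "\<bar>E n\<bar> \<le> \<bar>E N\<bar> * exp (\<Sum>k=N..<n. \<epsilon> k)" if "n \<ge> N" for n
    using that
  proof (induction n rule: dec_induct)
    case (step n)
    have "\<bar>E (Suc n)\<bar> \<le> \<bar>E n\<bar> + \<bar>E (Suc n) - E n\<bar>" by linarith
    also have "\<dots> \<le> \<bar>E n\<bar> * (1 + \<epsilon> n)"
      using N[of n] step.hyps by (simp add: algebra_simps)
    also have "\<dots> \<le> \<bar>E n\<bar> * exp (\<epsilon> n)"
      by (intro mult_left_mono exp_ge_add_one_self) auto
    also have "\<dots> \<le> \<bar>E N\<bar> * exp (\<Sum>k=N..<n. \<epsilon> k) * exp (\<epsilon> n)"
      using step.IH by (intro mult_right_mono) auto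
    also have "\<dots> = \<bar>E N\<bar> * exp (\<Sum>k=N..<Suc n. \<epsilon> k)"
      using step.hyps by (simp add: exp_add)
    finally show ?case .
  qed simp
  define C where "C = \<bar>E N\<bar> * exp (suminf \<epsilon>)"
  have bounded: "\<bar>E n\<bar> \<le> C" if "n \<ge> N" for n
  proof -
    have "(\<Sum>k=N..<n. \<epsilon> k) \<le> suminf \<epsilon>"
      using sum nonneg by (intro sum_le_suminf) auto
    then show ?thesis
      using growth[OF that] unfolding C_def
      by (meson abs_ge_zero exp_le_cancel_iff mult_left_mono order_trans)
  qed
  have "summable (\<lambda>n. E (Suc n) - E n)"
  proof (rule summable_comparison_test)
    have "norm (E (Suc n) - E n) \<le> C * \<epsilon> n" if "n \<ge> N" for n
      using N[OF that] mult_left_mono[OF bounded[OF that] nonneg[of n]]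
      by (simp add: mult.commute)
    then show "\<exists>N. \<forall>n\<ge>N. norm (E (Suc n) - E n) \<le> C * \<epsilon> n" by blast
    show "summable (\<lambda>n. C * \<epsilon> n)" using sum by (rule summable_mult)
  qed
  then have "convergent (\<lambda>n. \<Sum>k<n. E (Suc k) - E k)"
    by (simp add: summable_iff_convergent)
  then have "convergent (\<lambda>n. E n - E 0)"
    by (simp add: sum_lessThan_telescope)
  then show ?thesis by (simp add: convergent_diff_const_right_iff)
qed

text \<open>The first two terms together are conserved by the recurrence when \<open>g\<close> is constant; the third
  performs the summation by parts that leaves only a second difference of \<open>g\<close> at first order.\<close>

definition energy :: "(nat \<Rightarrow> real) \<Rightarrow> real \<Rightarrow> (nat \<Rightarrow> real) \<Rightarrow> nat \<Rightarrow> real" where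
  "energy g \<omega> x n = g n * ((x n)\<^sup>2 + (x (n + 1))\<^sup>2) - \<omega> * x n * x (n + 1) - s g n * (x n)\<^sup>2"

lemma energy_increment:
  assumes pos: "g (n + 1) > 0"
    and rec: "g (n + 1) * x (n + 2) = \<omega> * x (n + 1) - g n * x n"
  shows "energy g \<omega> x (Suc n) - energy g \<omega> x n =
    - ds g n * (x (n + 1))\<^sup>2 + (s g n)\<^sup>2 / g (n + 1) * (x n)\<^sup>2
      + \<omega> * s g n / g (n + 1) * (x n * x (n + 1))"
proof -
  have x2: "x (n + 2) = (\<omega> * x (n + 1) - g n * x n) / g (n + 1)"
    using pos rec by (simp add: field_simps)
  have nz: "g (n + 1) \<noteq> 0" using pos by simp
  have idx: "Suc n = n + 1" "n + 1 + 1 = n + 2" by auto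
  show ?thesis
    unfolding energy_def ds_def idx x2 s_def using nz
    by (simp add: field_simps power2_eq_square)
qed

lemma abs_mult_le_half_sum_squares: "\<bar>u * v\<bar> \<le> (u\<^sup>2 + v\<^sup>2) / 2" for u v :: real
proof -
  have "0 \<le> (\<bar>u\<bar> - \<bar>v\<bar>)\<^sup>2" by simp
  then show ?thesis by (simp add: power2_diff abs_mult)
qed

text \<open>Once \<open>g\<close> is large, the energy is comparable to the weighted sum of squares, so the bound on
  its increments becomes a relative one. The difference of the two quantities is at most a constant
  times the energy divided by \<open>g\<close>, hence both have the same limit.\<close>

lemma convergent_weighted_squares:
  assumes pos: "\<And>n. g n > 0"
    and rec: "\<And>n. g (n + 1) * x (n + 2) = \<omega> * x (n + 1) - g n * x n"
    and C1: "cond_C1 g" and C2: "cond_C2 g" and C6: "cond_C6 g" and C7: "cond_C7 g"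
  shows "convergent (\<lambda>n. g n * ((x n)\<^sup>2 + (x (n + 1))\<^sup>2))"
proof -
  define b where "b n = g n * ((x n)\<^sup>2 + (x (n + 1))\<^sup>2)" for n
  define E where "E = energy g \<omega> x"
  define \<epsilon> where "\<epsilon> n = 2 * (\<bar>ds g n\<bar> / g n + 2 * (1 + \<bar>\<omega>\<bar>) * (\<bar>s g n\<bar> / (g n)\<^sup>2))" for n
  have b_nonneg: "b n \<ge> 0" for n
    unfolding b_def using pos[of n] by (intro mult_nonneg_nonneg) auto
  have squares: "(x n)\<^sup>2 \<le> b n / g n" "(x (n + 1))\<^sup>2 \<le> b n / g n"
      "\<bar>x n * x (n + 1)\<bar> \<le> b n / g n" for n
  proof -
    have *: "b n / g n = (x n)\<^sup>2 + (x (n + 1))\<^sup>2"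
      unfolding b_def using pos[of n] by simp
    show "(x n)\<^sup>2 \<le> b n / g n" "(x (n + 1))\<^sup>2 \<le> b n / g n" unfolding * by auto
    show "\<bar>x n * x (n + 1)\<bar> \<le> b n / g n"
      unfolding * by (rule order_trans[OF abs_mult_le_half_sum_squares]) simp
  qed
  have large: "eventually (\<lambda>n. g n \<ge> 2 * \<bar>\<omega>\<bar> + 2) sequentially"
    using C1 by (simp add: cond_C1_def filterlim_at_top)
  have small: "eventually (\<lambda>n. \<bar>s g n\<bar> \<le> 1) sequentially"
  proof -
    have "eventually (\<lambda>n. dist (s g n) 0 < 1) sequentially"
      using C2 by (intro tendstoD) (auto simp: cond_C2_def)
    then show ?thesis by (rule eventually_mono) simp
  qed
  have close: "\<bar>E n - b n\<bar> \<le> (\<bar>\<omega>\<bar> + 1) * (b n / g n)" if "\<bar>s g n\<bar> \<le> 1" for n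
  proof -
    have "\<bar>E n - b n\<bar> \<le> \<bar>\<omega>\<bar> * \<bar>x n * x (n + 1)\<bar> + \<bar>s g n\<bar> * (x n)\<^sup>2"
    proof -
      have "E n - b n = - (\<omega> * (x n * x (n + 1))) - s g n * (x n)\<^sup>2"
        by (simp add: E_def b_def energy_def)
      then have "\<bar>E n - b n\<bar> \<le> \<bar>\<omega> * (x n * x (n + 1))\<bar> + \<bar>s g n * (x n)\<^sup>2\<bar>" by linarith
      then show ?thesis by (simp add: abs_mult)
    qed
    also have "\<dots> \<le> \<bar>\<omega>\<bar> * (b n / g n) + 1 * (b n / g n)"
      by (intro add_mono mult_mono that squares) auto
    finally show ?thesis by (simp only: distrib_right)
  qed
  \<comment> \<open>The threshold \<open>2 \<bar>\<omega>\<bar> + 2\<close> for \<open>g\<close> makes the correction terms at most half of \<open>b\<close>.\<close>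
  have compare: "b n \<le> 2 * E n" if "g n \<ge> 2 * \<bar>\<omega>\<bar> + 2" "\<bar>s g n\<bar> \<le> 1" for n
  proof -
    have "(\<bar>\<omega>\<bar> + 1) * (b n / g n) = (\<bar>\<omega>\<bar> + 1) / g n * b n" by simp
    also have "\<dots> \<le> 1 / 2 * b n"
      using that(1) pos[of n] b_nonneg[of n] by (intro mult_right_mono) (auto simp: field_simps)
    finally show ?thesis using close[OF that(2)] by linarith
  qed
  have "convergent E"
  proof (rule convergent_of_summable_relative_increments[where \<epsilon> = \<epsilon>])
    show "summable \<epsilon>"
      unfolding \<epsilon>_def using C6 C7
      by (intro summable_mult summable_add) (auto simp: cond_C6_def cond_C7_def)
    show "\<epsilon> n \<ge> 0" for n
      unfolding \<epsilon>_def using pos[of n] by (intro mult_nonneg_nonneg add_nonneg_nonneg) auto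
    show "eventually (\<lambda>n. \<bar>E (Suc n) - E n\<bar> \<le> \<epsilon> n * \<bar>E n\<bar>) sequentially"
      using large small
    proof eventually_elim
      case (elim n)
      \<comment> \<open>The increment contains \<open>g (n + 1)\<close> in its denominators, the summability conditions
        contain \<open>g n\<close>; slow variation makes the two comparable.\<close>
      have half: "g n / 2 \<le> g (n + 1)"
        using elim by (auto simp: s_def)
      have inv: "1 / g (n + 1) \<le> 2 / g n"
        using half pos[of n] pos[of "n + 1"] by (simp add: field_simps)
      have sg: "(s g n)\<^sup>2 \<le> \<bar>s g n\<bar>"
        using elim(2) mult_left_mono[of "\<bar>s g n\<bar>" 1 "\<bar>s g n\<bar>"]
        by (simp add: power2_eq_square flip: abs_mult)
      have "\<bar>E (Suc n) - E n\<bar> \<le> \<bar>ds g n * (x (n + 1))\<^sup>2\<bar>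
          + \<bar>(s g n)\<^sup>2 / g (n + 1) * (x n)\<^sup>2\<bar>
          + \<bar>\<omega> * s g n / g (n + 1) * (x n * x (n + 1))\<bar>"
        unfolding E_def energy_increment[OF pos rec] by linarith
      also have "\<dots> = \<bar>ds g n\<bar> * (x (n + 1))\<^sup>2
          + (s g n)\<^sup>2 * (1 / g (n + 1)) * (x n)\<^sup>2
          + \<bar>\<omega>\<bar> * \<bar>s g n\<bar> * (1 / g (n + 1)) * \<bar>x n * x (n + 1)\<bar>"
        using pos[of "n + 1"] by (simp add: abs_mult)
      also have "\<dots> \<le> \<bar>ds g n\<bar> * (b n / g n)
          + \<bar>s g n\<bar> * (2 / g n) * (b n / g n)
          + \<bar>\<omega>\<bar> * \<bar>s g n\<bar> * (2 / g n) * (b n / g n)"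
        using pos[of n] pos[of "n + 1"]
        by (intro add_mono mult_mono squares inv sg order_refl mult_nonneg_nonneg) auto
      also have "\<dots> = \<epsilon> n / 2 * b n"
        using pos[of n] by (simp add: \<epsilon>_def field_simps power2_eq_square)
      also have "\<dots> \<le> \<epsilon> n / 2 * (2 * E n)"
        using compare[OF elim] \<open>\<And>n. \<epsilon> n \<ge> 0\<close> by (intro mult_left_mono) auto
      also have "\<dots> \<le> \<epsilon> n * \<bar>E n\<bar>"
        using \<open>\<And>n. \<epsilon> n \<ge> 0\<close> by (simp add: mult_left_mono)
      finally show ?case .
    qed
  qed
  then obtain L where L: "E \<longlonglongrightarrow> L" by (auto simp: convergent_def)
  have "(\<lambda>n. E n - b n) \<longlonglongrightarrow> 0"
  proof (rule Lim_null_comparison)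
    show "eventually (\<lambda>n. norm (E n - b n) \<le> (\<bar>\<omega>\<bar> + 1) * (2 * E n / g n)) sequentially"
      using large small
    proof eventually_elim
      case (elim n)
      have "\<bar>E n - b n\<bar> \<le> (\<bar>\<omega>\<bar> + 1) * (b n / g n)" using close[OF elim(2)] .
      also have "\<dots> \<le> (\<bar>\<omega>\<bar> + 1) * (2 * E n / g n)"
        using compare[OF elim] pos[of n] by (intro mult_left_mono divide_right_mono) auto
      finally show ?case by simp
    qed
    have "(\<lambda>n. 2 * E n / g n) \<longlonglongrightarrow> 0"
      using C1 by (intro real_tendsto_divide_at_top[OF tendsto_mult_left[OF L]]) (simp add: cond_C1_def)
    then show "(\<lambda>n. (\<bar>\<omega>\<bar> + 1) * (2 * E n / g n)) \<longlonglongrightarrow> 0"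
      by (rule tendsto_mult_right_zero)
  qed
  from tendsto_diff[OF L this] have "b \<longlonglongrightarrow> L" by simp
  then show ?thesis unfolding b_def by (rule convergentI)
qed

section \<open>The Christoffel-Darboux kernel\<close>

lemma christoffel_darboux:
  fixes g x y :: "nat \<Rightarrow> real"
  assumes x0: "g 0 * x 1 = \<omega> * x 0"
    and x: "\<And>n. g (n + 1) * x (n + 2) = \<omega> * x (n + 1) - g n * x n"
    and y0: "g 0 * y 1 = \<sigma> * y 0"
    and y: "\<And>n. g (n + 1) * y (n + 2) = \<sigma> * y (n + 1) - g n * y n"
  shows "(\<omega> - \<sigma>) * (\<Sum>k\<le>n. x k * y k) = g n * (x (n + 1) * y n - x n * y (n + 1))"
proof (induction n)
  case 0
  have "g 0 * (x 1 * y 0 - x 0 * y 1) = (g 0 * x 1) * y 0 - x 0 * (g 0 * y 1)"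
    by (simp add: algebra_simps)
  also have "\<dots> = (\<omega> - \<sigma>) * (x 0 * y 0)" unfolding x0 y0 by (simp add: algebra_simps)
  finally show ?case by simp
next
  case (Suc n)
  have "g (n + 1) * (x (n + 2) * y (n + 1) - x (n + 1) * y (n + 2))
      = (g (n + 1) * x (n + 2)) * y (n + 1) - x (n + 1) * (g (n + 1) * y (n + 2))"
    by (simp add: algebra_simps)
  also have "\<dots> = (\<omega> - \<sigma>) * (x (n + 1) * y (n + 1)) + g n * (x (n + 1) * y n - x n * y (n + 1))"
    unfolding x y by (simp add: algebra_simps)
  finally show ?case using Suc.IH by (simp add: algebra_simps)
qed

text \<open>The right-hand side of the Christoffel-Darboux identity is bounded, because
  \<open>2 \<bar>u v\<bar> \<le> u\<^sup>2 + v\<^sup>2\<close> estimates it by the two weighted sums of squares.\<close>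

lemma bounded_kernel_sums:
  fixes g x y :: "nat \<Rightarrow> real"
  assumes pos: "\<And>n. g n > 0" and neq: "\<omega> \<noteq> \<sigma>"
    and x0: "g 0 * x 1 = \<omega> * x 0"
    and x: "\<And>n. g (n + 1) * x (n + 2) = \<omega> * x (n + 1) - g n * x n"
    and y0: "g 0 * y 1 = \<sigma> * y 0"
    and y: "\<And>n. g (n + 1) * y (n + 2) = \<sigma> * y (n + 1) - g n * y n"
    and bx: "Bseq (\<lambda>n. g n * ((x n)\<^sup>2 + (x (n + 1))\<^sup>2))"
    and "by": "Bseq (\<lambda>n. g n * ((y n)\<^sup>2 + (y (n + 1))\<^sup>2))"
  shows "Bseq (\<lambda>n. \<Sum>k\<le>n. x k * y k)"
proof -
  obtain A where A: "\<And>n. norm (g n * ((x n)\<^sup>2 + (x (n + 1))\<^sup>2)) \<le> A"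
    using bx by (auto simp: Bseq_def)
  obtain B where B: "\<And>n. norm (g n * ((y n)\<^sup>2 + (y (n + 1))\<^sup>2)) \<le> B"
    using "by" by (auto simp: Bseq_def)
  have "norm (\<Sum>k\<le>n. x k * y k) \<le> (A + B) / 2 / \<bar>\<omega> - \<sigma>\<bar>" for n
  proof -
    have "\<bar>\<omega> - \<sigma>\<bar> * \<bar>\<Sum>k\<le>n. x k * y k\<bar> = g n * \<bar>x (n + 1) * y n - x n * y (n + 1)\<bar>"
      using christoffel_darboux[where \<omega> = \<omega> and \<sigma> = \<sigma> and n = n, OF x0 x y0 y] pos[of n]
      by (metis abs_mult abs_of_pos)
    also have "\<dots> \<le> g n * ((((x n)\<^sup>2 + (x (n + 1))\<^sup>2) + ((y n)\<^sup>2 + (y (n + 1))\<^sup>2)) / 2)"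
    proof (intro mult_left_mono)
      have "\<bar>x (n + 1) * y n - x n * y (n + 1)\<bar> \<le> \<bar>x (n + 1) * y n\<bar> + \<bar>x n * y (n + 1)\<bar>"
        by (rule abs_triangle_ineq4)
      also have "\<dots> \<le> ((x (n + 1))\<^sup>2 + (y n)\<^sup>2) / 2 + ((x n)\<^sup>2 + (y (n + 1))\<^sup>2) / 2"
        by (intro add_mono abs_mult_le_half_sum_squares)
      finally show "\<bar>x (n + 1) * y n - x n * y (n + 1)\<bar>
          \<le> (((x n)\<^sup>2 + (x (n + 1))\<^sup>2) + ((y n)\<^sup>2 + (y (n + 1))\<^sup>2)) / 2"
        by (simp add: field_simps)
    qed (use pos[of n] in simp)
    also have "\<dots> \<le> (A + B) / 2"
      using A[of n] B[of n] by (simp add: algebra_simps)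
    finally show ?thesis using neq by (simp add: field_simps)
  qed
  then show ?thesis by (rule BseqI')
qed

section \<open>Chromatic derivatives of exponentials\<close>

lemma ddt_funpow_cexp: "(ddt ^^ n) (cexp \<omega>) = (\<lambda>t. (\<i> * complex_of_real \<omega>) ^ n * cexp \<omega> t)"
proof (induction n)
  case (Suc n)
  have "((\<lambda>t. (\<i> * complex_of_real \<omega>) ^ n * cexp \<omega> t) has_vector_derivative
      (\<i> * complex_of_real \<omega>) ^ Suc n * cexp \<omega> t) (at t)" for t
    unfolding cexp_def by (auto intro!: derivative_eq_intros has_vector_derivative_real_field)
  then show ?case
    using Suc by (auto simp: ddt_def vector_derivative_at)
qed simp

lemma infinitely_differentiable_cexp: "infinitely_differentiable (cexp \<omega>)"
  unfolding infinitely_differentiable_def ddt_funpow_cexp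
proof (intro allI)
  fix n t
  have "((\<lambda>t. (\<i> * complex_of_real \<omega>) ^ n * cexp \<omega> t) has_vector_derivative
      (\<i> * complex_of_real \<omega>) ^ Suc n * cexp \<omega> t) (at t)"
    unfolding cexp_def by (auto intro!: derivative_eq_intros has_vector_derivative_real_field)
  then show "(\<lambda>t. (\<i> * complex_of_real \<omega>) ^ n * cexp \<omega> t) differentiable at t"
    by (rule differentiableI_vector)
qed

lemma chromatic_deriv_cexp:
  "chromatic_deriv p n (cexp \<omega>) t = \<i> ^ n * complex_of_real (poly (p n) \<omega>) * cexp \<omega> t"
proof -
  have "(- \<i>) ^ k * (\<i> * complex_of_real \<omega>) ^ k = complex_of_real \<omega> ^ k" for k
    by (simp flip: power_mult_distrib)
  then have *: "c * (- \<i>) ^ k * ((\<i> * complex_of_real \<omega>) ^ k * e) = c * complex_of_real \<omega> ^ k * e"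
    for c e k by (simp add: mult.assoc)
  show ?thesis
    unfolding chromatic_deriv_def ddt_funpow_cexp * poly_altdef
    by (simp add: sum_distrib_right mult.assoc)
qed

lemma cmod_cexp: "cmod (cexp \<omega> t) = 1"
  by (simp add: cexp_def)

lemma beta_cexp:
  "beta p \<gamma> (cexp \<omega>) n t = \<gamma> n * ((poly (p n) \<omega>)\<^sup>2 + (poly (p (n + 1)) \<omega>)\<^sup>2)"
  by (simp add: beta_def chromatic_deriv_cexp norm_mult norm_power cmod_cexp)

lemma cnj_cexp: "cnj (cexp \<sigma> t) = cexp (- \<sigma>) t"
  by (simp add: cexp_def exp_cnj)

context
  fixes p \<gamma>
  assumes rec: "recurrence_coeffs p \<gamma>"
begin

lemma poly_recurrence_0: "p 0 = 1 \<Longrightarrow> \<gamma> 0 * poly (p 1) \<omega> = \<omega> * poly (p 0) \<omega>"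
  using rec by (auto simp: recurrence_coeffs_def less_imp_neq[THEN not_sym])

lemma poly_recurrence:
  "\<gamma> (n + 1) * poly (p (n + 2)) \<omega> = \<omega> * poly (p (n + 1)) \<omega> - \<gamma> n * poly (p n) \<omega>"
proof -
  have "\<gamma> (n + 1) \<noteq> 0" using rec by (metis recurrence_coeffs_def less_irrefl)
  moreover have "p (n + 2) = Polynomial.smult (1 / \<gamma> (n + 1)) ([:0, 1:] * p (n + 1))
                        - Polynomial.smult (\<gamma> n / \<gamma> (n + 1)) (p n)"
    using rec unfolding recurrence_coeffs_def by blast
  ultimately show ?thesis by (simp only: poly_diff poly_smult poly_mult) (simp add: field_simps)
qed

text \<open>The parity of the polynomials is read off from the recurrence, which has no constant term
  in the coefficient of \<open>p\<^sub>n\<^sub>+\<^sub>1\<close>; this is where the symmetry of the functional enters.\<close>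

lemma poly_minus_arg:
  assumes "p 0 = 1"
  shows "poly (p n) (- \<omega>) = (- 1) ^ n * poly (p n) \<omega>"
proof -
  have pos: "\<gamma> n \<noteq> 0" for n using rec by (metis recurrence_coeffs_def less_irrefl)
  have "poly (p n) (- \<omega>) = (- 1) ^ n * poly (p n) \<omega> \<and>
        poly (p (n + 1)) (- \<omega>) = (- 1) ^ (n + 1) * poly (p (n + 1)) \<omega>"
  proof (induction n)
    case 0
    have "\<gamma> 0 * poly (p 1) (- \<omega>) = \<gamma> 0 * (- poly (p 1) \<omega>)"
      using poly_recurrence_0[OF assms, of \<omega>] poly_recurrence_0[OF assms, of "- \<omega>"] assms
      by simp
    then have "poly (p 1) (- \<omega>) = - poly (p 1) \<omega>" using pos[of 0] by (metis mult_left_cancel)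
    then show ?case using assms by simp
  next
    case (Suc n)
    have "\<gamma> (n + 1) * poly (p (n + 2)) (- \<omega>)
        = (- 1) ^ n * (\<omega> * poly (p (n + 1)) \<omega> - \<gamma> n * poly (p n) \<omega>)"
      unfolding poly_recurrence using Suc.IH by (simp add: algebra_simps)
    also have "\<dots> = \<gamma> (n + 1) * ((- 1) ^ n * poly (p (n + 2)) \<omega>)"
      unfolding poly_recurrence[symmetric] by simp
    finally have "poly (p (n + 2)) (- \<omega>) = (- 1) ^ n * poly (p (n + 2)) \<omega>"
      using pos[of "n + 1"] by (metis mult_left_cancel)
    then show ?case using Suc.IH by simp
  qed
  then show ?thesis by blast
qed

lemma chromatic_deriv_product_cexp:
  assumes "p 0 = 1"
  shows "chromatic_deriv p k (cexp \<omega>) t * chromatic_deriv p k (\<lambda>u. cnj (cexp \<sigma> u)) t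
    = complex_of_real (poly (p k) \<omega> * poly (p k) \<sigma>) * cexp (\<omega> - \<sigma>) t"
proof -
  have e: "cexp \<omega> t * cexp (- \<sigma>) t = cexp (\<omega> - \<sigma>) t"
    by (simp add: cexp_def algebra_simps flip: exp_add)
  have i: "\<i> ^ k * \<i> ^ k * (- 1) ^ k = 1"
    by (simp flip: power_mult_distrib)
  have conj: "(\<lambda>u. cnj (cexp \<sigma> u)) = cexp (- \<sigma>)" by (simp add: cnj_cexp fun_eq_iff)
  have "chromatic_deriv p k (cexp \<omega>) t * chromatic_deriv p k (\<lambda>u. cnj (cexp \<sigma> u)) t
      = (\<i> ^ k * \<i> ^ k * (- 1) ^ k) * complex_of_real (poly (p k) \<omega> * poly (p k) \<sigma>)
          * (cexp \<omega> t * cexp (- \<sigma>) t)"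
    by (simp add: conj chromatic_deriv_cexp poly_minus_arg[OF assms] mult_ac)
  then show ?thesis by (simp add: e i)
qed

end

section \<open>Orthogonality of exponentials\<close>

theorem theorem6p9:
  fixes M :: "real poly \<Rightarrow> real" and p :: "nat \<Rightarrow> real poly" and \<gamma> :: "nat \<Rightarrow> real"
  assumes "symmetric_moment_functional M"
    and "orthonormal_polys M p"
    and "recurrence_coeffs p \<gamma>"
    and "cond_C1 \<gamma>" and "cond_C2 \<gamma>" and "cond_C3 \<gamma>" and "cond_C4 \<gamma>"
    and "cond_C5 \<gamma>" and "cond_C6 \<gamma>" and "cond_C7 \<gamma>"
  shows "(\<forall>\<omega>. cexp \<omega> \<in> space_B p \<gamma> \<and> B0_rel p \<gamma> `` {cexp \<omega>} \<in> space_B2 p \<gamma>) \<and>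
    (\<forall>\<omega> \<sigma> t. \<omega> \<noteq> \<sigma> \<longrightarrow>
      (\<lambda>n. (\<Sum>k\<le>n. chromatic_deriv p k (cexp \<omega>) t * chromatic_deriv p k (\<lambda>u. cnj (cexp \<sigma> u)) t)
             / complex_of_real (\<Sum>j\<le>n. 1 / \<gamma> j)) \<longlonglongrightarrow> 0)"
proof (intro conjI allI impI)
  note rec = \<open>recurrence_coeffs p \<gamma>\<close>
  have p0: "p 0 = 1" using assms(2) by (simp add: orthonormal_polys_def)
  have pos: "\<gamma> n > 0" for n using rec by (simp add: recurrence_coeffs_def)
  have conv: "convergent (\<lambda>n. \<gamma> n * ((poly (p n) \<omega>)\<^sup>2 + (poly (p (n + 1)) \<omega>)\<^sup>2))" for \<omega>
    using convergent_weighted_squares[where x = "\<lambda>n. poly (p n) \<omega>", OF pos poly_recurrence[OF rec]]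
      assms by blast
  show B: "cexp \<omega> \<in> space_B p \<gamma>" for \<omega>
  proof -
    obtain L where L: "(\<lambda>n. \<gamma> n * ((poly (p n) \<omega>)\<^sup>2 + (poly (p (n + 1)) \<omega>)\<^sup>2)) \<longlonglongrightarrow> L"
      using conv[of \<omega>] by (auto simp: convergent_def)
    have "uniform_limit S (beta p \<gamma> (cexp \<omega>)) (\<lambda>_. L) sequentially" for S
      using L by (auto simp: uniform_limit_iff beta_cexp tendsto_iff elim!: eventually_mono)
    then show ?thesis
      by (auto simp: space_B_def infinitely_differentiable_cexp uniformly_convergent_on_def)
  qed
  show "B0_rel p \<gamma> `` {cexp \<omega>} \<in> space_B2 p \<gamma>" for \<omega>
    unfolding space_B2_def by (intro quotientI B)
  fix \<omega> \<sigma> t :: real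
  assume "\<omega> \<noteq> \<sigma>"
  let ?S = "\<lambda>n. \<Sum>k\<le>n. poly (p k) \<omega> * poly (p k) \<sigma>"
  have "Bseq ?S"
    by (rule bounded_kernel_sums[where \<omega> = \<omega> and \<sigma> = \<sigma> and g = \<gamma>])
       (auto intro!: pos \<open>\<omega> \<noteq> \<sigma>\<close> poly_recurrence_0[OF rec p0, simplified] poly_recurrence[OF rec, simplified]
          convergent_imp_Bseq conv[simplified])
  then obtain K where K: "\<And>n. norm (?S n) \<le> K" by (auto simp: Bseq_def)
  have "(\<lambda>n. inverse (\<Sum>j\<le>n. 1 / \<gamma> j)) \<longlonglongrightarrow> 0"
    using assms(7) by (intro tendsto_inverse_0_at_top) (simp add: cond_C4_def)
  then have "(\<lambda>n. ?S n * inverse (\<Sum>j\<le>n. 1 / \<gamma> j)) \<longlonglongrightarrow> 0"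
    by (rule lim_null_mult_left_bounded[where B = K, rotated]) (simp add: K del: real_norm_def)
  then have "(\<lambda>n. ?S n / (\<Sum>j\<le>n. 1 / \<gamma> j)) \<longlonglongrightarrow> 0" by (simp only: divide_inverse)
  then have "(\<lambda>n. complex_of_real (?S n / (\<Sum>j\<le>n. 1 / \<gamma> j)) * cexp (\<omega> - \<sigma>) t) \<longlonglongrightarrow> 0"
    by (intro tendsto_mult_left_zero) (metis of_real_0 tendsto_of_real)
  then show "(\<lambda>n. (\<Sum>k\<le>n. chromatic_deriv p k (cexp \<omega>) t
        * chromatic_deriv p k (\<lambda>u. cnj (cexp \<sigma> u)) t)
      / complex_of_real (\<Sum>j\<le>n. 1 / \<gamma> j)) \<longlonglongrightarrow> 0"
    by (simp add: chromatic_deriv_product_cexp[OF rec p0] sum_distrib_right)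
qed

end
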